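(* Let $(\mathbf T,\mathbf C,\mathbf A)$ (with its operators and substitution functions) be an original psi-calculus over a countably infinite set $\mathcal N$ of names, and suppose that $\mathrm n(N\sigma)\supseteq \mathrm n(N)\setminus\mathrm n(\sigma)$ for all terms $N\in\mathbf T$ and all substitutions $\sigma$. Let $\mathbf X=\mathbf T$ (with the same substitution function), $\mathrm{vars}(X)=\mathcal P(\mathrm n(X))$, $\mathrm{Match}(M,\tilde x,X)=\{\tilde L : M=X[\tilde x:=\tilde L]\}$, $\mathcal S=\mathcal S_{\mathcal N}=\mathcal S_\nu=\{s\}$, $\underline{\propto}=\overline{\propto}=\prec\,=\{(s,s)\}$, and $\mathrm{SORT}:\mathcal N\uplus\mathbf T\uplus\mathbf X\to\{s\}$. Then $(\mathbf T,\mathbf X,\mathbf C,\mathbf A)$ with these parameters is a sorted psi-calculus.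
   Context: **Nominal sets.** Names are partitioned into countably infinite sets $\mathcal N_s$, one for each name sort $s\in\mathcal S_{\mathcal N}$; $\mathcal N=\bigcup_s\mathcal N_s$. A tilde denotes a finite tuple; $\tilde x$ also denotes the set of its entries. Swappings $(a\ b)$ are only considered for names of the same sort; $(\tilde a\ \tilde b)$ is the pointwise swapping of equally long tuples. A nominal set is a set with an action of these swappings in which each element $T$ has finite support $\mathrm n(T)\subset\mathcal N$; $a\#T$ means $a\notin \mathrm n(T)$, extended to tuples by conjunction. Functions, relations and constants are equivariant if preserved by all swappings; every sort is equivariant. $\mathcal P$ and $\mathcal P_{\rm fin}$ denote power set and set of finite subsets. **Logical parameters.** Nominal sets $\mathbf T$ (terms), $\mathbf C$ (conditions), $\mathbf A$ (assertions), with equivariant $\leftrightarrow:\mathbf T\times\mathbf T\to\mathbf C$ (channel equivalence), $\otimes:\mathbf A\times\mathbf A\to\mathbf A$, $\mathbf 1\in\mathbf A$, $\vdash\;\subseteq\mathbf A\times\mathbf C$. Write $\Psi\simeq\Psi'$ if $\Psi\vdash\varphi\Leftrightarrow\Psi'\vdash\varphi$ for all $\varphi\in\mathbf C$. Required: $\Psi\vdash M\leftrightarrow N$ implies $\Psi\vdash N\leftrightarrow M$; $\Psi\vdash M\leftrightarrow N$ and $\Psi\vdash N\leftrightarrow L$ imply $\Psi\vdash M\leftrightarrow L$; $\Psi_1\simeq\Psi_2$ implies $\Psi\otimes\Psi_1\simeq\Psi\otimes\Psi_2$; $(\mathbf A,\otimes,\mathbf 1)$ is an abelian monoid modulo $\simeq$.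 **Original psi-calculus.** There is a single sort of names. It consists of logical parameters $\mathbf T,\mathbf C,\mathbf A,\leftrightarrow,\otimes,\mathbf 1,\vdash$ together with, on each of $\mathbf T,\mathbf C,\mathbf A$, an equivariant substitution function $T\mapsto T[\tilde a:=\tilde N]$, for $\tilde a$ a tuple of distinct names and $\tilde N$ an equally long tuple of terms, such that (i) if $\tilde a\subseteq\mathrm n(T)$ and $b\in\mathrm n(\tilde N)$ then $b\in\mathrm n(T[\tilde a:=\tilde N])$; (ii) if $\tilde b\#T,\tilde a$ then $T[\tilde a:=\tilde N]=((\tilde a\ \tilde b)\cdot T)[\tilde b:=\tilde N]$. For $\sigma=[\tilde a:=\tilde N]$, $\mathrm n(\sigma)=\mathrm n(\tilde a)\cup\mathrm n(\tilde N)$. **Sorted psi-calculus.** It consists of a set of sorts $\mathcal S$, name sorts $\mathcal S_{\mathcal N}\subseteq\mathcal S$ (countable), logical parameters $\mathbf T,\mathbf C,\mathbf A,\leftrightarrow,\otimes,\mathbf 1,\vdash$, and: - a nominal set $\mathbf X$ of patterns, and equivariant $\mathrm{Match}:\mathbf T\times\mathcal N^*\times\mathbf X\to\mathcal P_{\rm fin}(\mathbf T^* )$ and $\mathrm{vars}:\mathbf X\to\mathcal P_{\rm fin}(\mathcal P_{\rm fin}(\mathcal N))$; - an equivariant $\mathrm{SORT}:\mathcal N\uplus\mathbf T\uplus\mathbf X\to\mathcal S$ with $\mathrm{SORT}(a)=s$ iff $a\in\mathcal N_s$, and predicates $\underline\propto$ (can receive), $\overline\propto$ (can send), $\prec$ (can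 be substituted by) $\subseteq\mathcal S\times\mathcal S$ and $\mathcal S_\nu\subseteq\mathcal S_{\mathcal N}$ (restrictable sorts). Define $s_1\le_{\mathbf T}s_2$ iff for all $t\in\mathcal S$: $(s_2\underline\propto t\Rightarrow s_1\underline\propto t)$, $(s_2\overline\propto t\Rightarrow s_1\overline\propto t)$ and $(t\overline\propto s_2\Rightarrow t\overline\propto s_1)$; and $s_1\le_{\mathbf X}s_2$ iff for all $t\in\mathcal S$: $t\underline\propto s_2\Rightarrow t\underline\propto s_1$. A substitution $\sigma=[\tilde a:=\tilde N]$ consists of a tuple of distinct names and an equally long tuple of terms with $\mathrm{SORT}(a_i)\prec\mathrm{SORT}(N_i)$ for all $i$. Requirements on substitution: on each of $\mathbf T,\mathbf C,\mathbf A$ there is an equivariant substitution function satisfying: if $\tilde b\#T,\tilde a$ then $T[\tilde a:=\tilde N]=((\tilde a\ \tilde b)\cdot T)[\tilde b:=\tilde N]$ (alpha-renaming); for terms also $\mathrm{SORT}(M\sigma)\le_{\mathbf T}\mathrm{SORT}(M)$. On $\mathbf X$ there is an equivariant substitution function such that if $\tilde x\in\mathrm{vars}(X)$ and $\tilde x\#\sigma$, where $\sigma=[\tilde a:=\tilde N]$, then $\mathrm{SORT}(X\sigma)\le_{\mathbf X}\mathrm{SORT}(X)$, $\tilde x\in\mathrm{vars}(X\sigma)$, and $X[\tilde a:=\tilde N]=((\tilde a\ \tilde b)\cdot X)[\tilde b:=\tilde N]$ whenever $\tilde b\#X,\tilde a$ (alpha-renaming for $\sigma$ and $X$). Requirements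 on matching: if $\tilde x\in\mathrm{vars}(X)$ are distinct and $\tilde N\in\mathrm{Match}(M,\tilde x,X)$ then $[\tilde x:=\tilde N]$ is a substitution, $\mathrm n(\tilde N)\subseteq\mathrm n(M)\cup(\mathrm n(X)\setminus\tilde x)$, and for all swappings $(\tilde x\ \tilde y)$ with $\tilde y\#X$ we have $\tilde N\in\mathrm{Match}(M,\tilde y,(\tilde x\ \tilde y)\cdot X)$. In the definition of $\mathrm{Match}$ in the claim, $\tilde L$ ranges over those tuples for which $[\tilde x:=\tilde L]$ is a substitution.
   Formalization: Match as defined need not be finite-valued (for T = N, Match(a,x,a) is infinite), so all requirements are proved with P in place of P_fin for the codomain of Match, and the full claim is proved exactly when Match is finite-valued. *)

theory Defs
  imports "HOL-Combinatorics.Transposition" "HOL-Library.Countable_Set" "HOL-Library.Disjoint_Sets"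
begin

text \<open>
  The names of sort \<open>s\<close> form the set \<open>N s\<close>.
  The relation \<open>R\<close> below consists of the pairs \<open>(a, b)\<close> for which the swapping
  \<open>(a b)\<close> is allowed, i.e. of the pairs of names of the same sort.
\<close>

definition name_partition :: "'s set \<Rightarrow> ('s \<Rightarrow> 'n set) \<Rightarrow> bool" where
  "name_partition SN N \<longleftrightarrow>
     (\<forall>s\<in>SN. countable (N s) \<and> infinite (N s)) \<and> disjoint_family_on N SN"

definition swappings :: "'s set \<Rightarrow> ('s \<Rightarrow> 'n set) \<Rightarrow> ('n \<times> 'n) set" where
  "swappings SN N = (\<Union>s\<in>SN. N s \<times> N s)"

record ('n, 'a) nominal =
  elts :: "'a set"
  swp :: "'n \<Rightarrow> 'n \<Rightarrow> 'a \<Rightarrow> 'a"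

definition supp :: "('n \<times> 'n) set \<Rightarrow> ('n, 'a) nominal \<Rightarrow> 'a \<Rightarrow> 'n set" where
  "supp R A x = {a. infinite {b. (a, b) \<in> R \<and> swp A a b x \<noteq> x}}"

text \<open>
  An action of the swappings is an action of the group generated by them. The first four
  conditions below are the usual presentation of this by generators and relations.
\<close>

definition nominal_set :: "('n \<times> 'n) set \<Rightarrow> ('n, 'a) nominal \<Rightarrow> bool" where
  "nominal_set R A \<longleftrightarrow>
     (\<forall>(a, b)\<in>R. \<forall>x\<in>elts A. swp A a b x \<in> elts A) \<and>
     (\<forall>(a, b)\<in>R. \<forall>x\<in>elts A. swp A a a x = x) \<and>
     (\<forall>(a, b)\<in>R. \<forall>x\<in>elts A. swp A a b (swp A a b x) = x) \<and>
     (\<forall>(a, b)\<in>R. \<forall>(c, d)\<in>R. \<forall>x\<in>elts A.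
        swp A a b (swp A c d x) = swp A (transpose a b c) (transpose a b d) (swp A a b x)) \<and>
     (\<forall>x\<in>elts A. finite (supp R A x))"

definition supp_tuple :: "('n \<times> 'n) set \<Rightarrow> ('n, 'a) nominal \<Rightarrow> 'a list \<Rightarrow> 'n set" where
  "supp_tuple R A xs = (\<Union>x\<in>set xs. supp R A x)"

text \<open>
  Pointwise swapping of equally long tuples. Both tuples have to consist of distinct names.
  The single swappings are applied from left to right, which matters only if the tuples overlap.
\<close>

definition tuple_swapping :: "('n \<times> 'n) set \<Rightarrow> 'n list \<Rightarrow> 'n list \<Rightarrow> bool" where
  "tuple_swapping R as bs \<longleftrightarrow> distinct as \<and> distinct bs \<and> list_all2 (\<lambda>a b. (a, b) \<in> R) as bs"

definition swp_tuple :: "('n, 'a) nominal \<Rightarrow> 'n list \<Rightarrow> 'n list \<Rightarrow> 'a \<Rightarrow> 'a" where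
  "swp_tuple A as bs x = fold (\<lambda>(a, b). swp A a b) (zip as bs) x"

text \<open>
  The substitution functions are total in HOL, but all requirements on \<open>f x as Ms\<close>, which stands
  for \<open>x[as := Ms]\<close>, are imposed only if \<open>[as := Ms]\<close> is a substitution.
\<close>

record ('n, 't, 'c, 'a) psi_params =
  Trm :: "('n, 't) nominal"
  Cnd :: "('n, 'c) nominal"
  Ass :: "('n, 'a) nominal"
  chan_eq :: "'t \<Rightarrow> 't \<Rightarrow> 'c"
  compose :: "'a \<Rightarrow> 'a \<Rightarrow> 'a"
  unit_ass :: "'a"
  entails :: "'a \<Rightarrow> 'c \<Rightarrow> bool"
  substT :: "'t \<Rightarrow> 'n list \<Rightarrow> 't list \<Rightarrow> 't"
  substC :: "'c \<Rightarrow> 'n list \<Rightarrow> 't list \<Rightarrow> 'c"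
  substA :: "'a \<Rightarrow> 'n list \<Rightarrow> 't list \<Rightarrow> 'a"

definition ass_equiv :: "('n, 't, 'c, 'a) psi_params \<Rightarrow> 'a \<Rightarrow> 'a \<Rightarrow> bool" where
  "ass_equiv P \<Psi> \<Psi>' \<longleftrightarrow> (\<forall>\<phi>\<in>elts (Cnd P). entails P \<Psi> \<phi> \<longleftrightarrow> entails P \<Psi>' \<phi>)"

definition logical_parameters :: "('n \<times> 'n) set \<Rightarrow> ('n, 't, 'c, 'a) psi_params \<Rightarrow> bool" where
  "logical_parameters R P \<longleftrightarrow>
     nominal_set R (Trm P) \<and> nominal_set R (Cnd P) \<and> nominal_set R (Ass P) \<and>
     (\<forall>M\<in>elts (Trm P). \<forall>N\<in>elts (Trm P). chan_eq P M N \<in> elts (Cnd P)) \<and>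
     (\<forall>\<Psi>\<in>elts (Ass P). \<forall>\<Psi>'\<in>elts (Ass P). compose P \<Psi> \<Psi>' \<in> elts (Ass P)) \<and>
     unit_ass P \<in> elts (Ass P) \<and>
     (\<forall>(a, b)\<in>R. \<forall>M\<in>elts (Trm P). \<forall>N\<in>elts (Trm P).
        swp (Cnd P) a b (chan_eq P M N) = chan_eq P (swp (Trm P) a b M) (swp (Trm P) a b N)) \<and>
     (\<forall>(a, b)\<in>R. \<forall>\<Psi>\<in>elts (Ass P). \<forall>\<Psi>'\<in>elts (Ass P).
        swp (Ass P) a b (compose P \<Psi> \<Psi>') = compose P (swp (Ass P) a b \<Psi>) (swp (Ass P) a b \<Psi>')) \<and>
     (\<forall>(a, b)\<in>R. swp (Ass P) a b (unit_ass P) = unit_ass P) \<and>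
     (\<forall>(a, b)\<in>R. \<forall>\<Psi>\<in>elts (Ass P). \<forall>\<phi>\<in>elts (Cnd P).
        entails P (swp (Ass P) a b \<Psi>) (swp (Cnd P) a b \<phi>) \<longleftrightarrow> entails P \<Psi> \<phi>) \<and>
     (\<forall>\<Psi>\<in>elts (Ass P). \<forall>M\<in>elts (Trm P). \<forall>N\<in>elts (Trm P).
        entails P \<Psi> (chan_eq P M N) \<longrightarrow> entails P \<Psi> (chan_eq P N M)) \<and>
     (\<forall>\<Psi>\<in>elts (Ass P). \<forall>M\<in>elts (Trm P). \<forall>N\<in>elts (Trm P). \<forall>L\<in>elts (Trm P).
        entails P \<Psi> (chan_eq P M N) \<and> entails P \<Psi> (chan_eq P N L) \<longrightarrow>
        entails P \<Psi> (chan_eq P M L)) \<and>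
     (\<forall>\<Psi>\<in>elts (Ass P). \<forall>\<Psi>1\<in>elts (Ass P). \<forall>\<Psi>2\<in>elts (Ass P).
        ass_equiv P \<Psi>1 \<Psi>2 \<longrightarrow> ass_equiv P (compose P \<Psi> \<Psi>1) (compose P \<Psi> \<Psi>2)) \<and>
     (\<forall>\<Psi>1\<in>elts (Ass P). \<forall>\<Psi>2\<in>elts (Ass P). \<forall>\<Psi>3\<in>elts (Ass P).
        ass_equiv P (compose P (compose P \<Psi>1 \<Psi>2) \<Psi>3) (compose P \<Psi>1 (compose P \<Psi>2 \<Psi>3))) \<and>
     (\<forall>\<Psi>1\<in>elts (Ass P). \<forall>\<Psi>2\<in>elts (Ass P).
        ass_equiv P (compose P \<Psi>1 \<Psi>2) (compose P \<Psi>2 \<Psi>1)) \<and>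
     (\<forall>\<Psi>\<in>elts (Ass P). ass_equiv P (compose P \<Psi> (unit_ass P)) \<Psi>)"

text \<open>
  \<open>is_subst ok as Ms\<close> states that \<open>[as := Ms]\<close> is a substitution, where \<open>ok a M\<close> tells whether
  the name \<open>a\<close> may be substituted by the term \<open>M\<close>.
\<close>

definition is_subst :: "('n \<Rightarrow> 't \<Rightarrow> bool) \<Rightarrow> 'n list \<Rightarrow> 't list \<Rightarrow> bool" where
  "is_subst ok as Ms \<longleftrightarrow> distinct as \<and> list_all2 ok as Ms"

definition subst_names :: "('n \<times> 'n) set \<Rightarrow> ('n, 't) nominal \<Rightarrow> 'n list \<Rightarrow> 't list \<Rightarrow> 'n set" where
  "subst_names R T as Ms = set as \<union> supp_tuple R T Ms"

definition equivariant_subst ::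
  "('n \<times> 'n) set \<Rightarrow> ('n \<Rightarrow> 't \<Rightarrow> bool) \<Rightarrow> ('n, 't) nominal \<Rightarrow> ('n, 'x) nominal \<Rightarrow>
   ('x \<Rightarrow> 'n list \<Rightarrow> 't list \<Rightarrow> 'x) \<Rightarrow> bool" where
  "equivariant_subst R ok T A f \<longleftrightarrow>
     (\<forall>x\<in>elts A. \<forall>as Ms. is_subst ok as Ms \<longrightarrow>
        f x as Ms \<in> elts A \<and>
        (\<forall>(c, d)\<in>R. swp A c d (f x as Ms) =
           f (swp A c d x) (map (transpose c d) as) (map (swp T c d) Ms)))"

definition alpha_renaming ::
  "('n \<times> 'n) set \<Rightarrow> ('n, 'x) nominal \<Rightarrow> ('x \<Rightarrow> 'n list \<Rightarrow> 't list \<Rightarrow> 'x) \<Rightarrow>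
   'x \<Rightarrow> 'n list \<Rightarrow> 't list \<Rightarrow> bool" where
  "alpha_renaming R A f x as Ms \<longleftrightarrow>
     (\<forall>bs. tuple_swapping R as bs \<and> set bs \<inter> supp R A x = {} \<and> set bs \<inter> set as = {} \<longrightarrow>
        f x as Ms = f (swp_tuple A as bs x) bs Ms)"

definition orig_ok :: "'n set \<Rightarrow> ('n, 't, 'c, 'a) psi_params \<Rightarrow> 'n \<Rightarrow> 't \<Rightarrow> bool" where
  "orig_ok N P a M \<longleftrightarrow> a \<in> N \<and> M \<in> elts (Trm P)"

definition orig_subst_function ::
  "'n set \<Rightarrow> ('n, 't, 'c, 'a) psi_params \<Rightarrow> ('n, 'x) nominal \<Rightarrow>
   ('x \<Rightarrow> 'n list \<Rightarrow> 't list \<Rightarrow> 'x) \<Rightarrow> bool" where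
  "orig_subst_function N P A f \<longleftrightarrow>
     equivariant_subst (N \<times> N) (orig_ok N P) (Trm P) A f \<and>
     (\<forall>x\<in>elts A. \<forall>as Ms. is_subst (orig_ok N P) as Ms \<longrightarrow>
        (set as \<subseteq> supp (N \<times> N) A x \<longrightarrow>
           supp_tuple (N \<times> N) (Trm P) Ms \<subseteq> supp (N \<times> N) A (f x as Ms)) \<and>
        alpha_renaming (N \<times> N) A f x as Ms)"

definition original_psi_calculus :: "'n set \<Rightarrow> ('n, 't, 'c, 'a) psi_params \<Rightarrow> bool" where
  "original_psi_calculus N P \<longleftrightarrow>
     countable N \<and> infinite N \<and>
     logical_parameters (N \<times> N) P \<and>
     orig_subst_function N P (Trm P) (substT P) \<and>
     orig_subst_function N P (Cnd P) (substC P) \<and>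
     orig_subst_function N P (Ass P) (substA P)"

text \<open>
  The additional parameters of a sorted psi-calculus. The three summands of the domain of \<open>sort_of\<close>
  are the names, the terms and the patterns.
\<close>

record ('s, 'n, 't, 'x) sort_params =
  sorts :: "'s set"
  name_sorts :: "'s set"
  restrictable :: "'s set"
  names_of :: "'s \<Rightarrow> 'n set"
  can_receive :: "('s \<times> 's) set"
  can_send :: "('s \<times> 's) set"
  substitutable :: "('s \<times> 's) set"
  sort_of :: "'n + 't + 'x \<Rightarrow> 's"
  Pat :: "('n, 'x) nominal"
  substX :: "'x \<Rightarrow> 'n list \<Rightarrow> 't list \<Rightarrow> 'x"
  vars :: "'x \<Rightarrow> 'n set set"
  match :: "'t \<Rightarrow> 'n list \<Rightarrow> 'x \<Rightarrow> 't list set"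

definition all_names :: "('s, 'n, 't, 'x) sort_params \<Rightarrow> 'n set" where
  "all_names Q = (\<Union>s\<in>name_sorts Q. names_of Q s)"

definition swaps :: "('s, 'n, 't, 'x) sort_params \<Rightarrow> ('n \<times> 'n) set" where
  "swaps Q = swappings (name_sorts Q) (names_of Q)"

definition le_term_sort :: "('s, 'n, 't, 'x) sort_params \<Rightarrow> 's \<Rightarrow> 's \<Rightarrow> bool" where
  "le_term_sort Q s1 s2 \<longleftrightarrow>
     (\<forall>t\<in>sorts Q.
        ((s2, t) \<in> can_receive Q \<longrightarrow> (s1, t) \<in> can_receive Q) \<and>
        ((s2, t) \<in> can_send Q \<longrightarrow> (s1, t) \<in> can_send Q) \<and>
        ((t, s2) \<in> can_send Q \<longrightarrow> (t, s1) \<in> can_send Q))"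

definition le_pattern_sort :: "('s, 'n, 't, 'x) sort_params \<Rightarrow> 's \<Rightarrow> 's \<Rightarrow> bool" where
  "le_pattern_sort Q s1 s2 \<longleftrightarrow>
     (\<forall>t\<in>sorts Q. (t, s2) \<in> can_receive Q \<longrightarrow> (t, s1) \<in> can_receive Q)"

definition sorted_ok ::
  "('n, 't, 'c, 'a) psi_params \<Rightarrow> ('s, 'n, 't, 'x) sort_params \<Rightarrow> 'n \<Rightarrow> 't \<Rightarrow> bool" where
  "sorted_ok P Q a M \<longleftrightarrow>
     a \<in> all_names Q \<and> M \<in> elts (Trm P) \<and> (sort_of Q (Inl a), sort_of Q (Inr (Inl M))) \<in> substitutable Q"

definition sort_system ::
  "('n, 't, 'c, 'a) psi_params \<Rightarrow> ('s, 'n, 't, 'x) sort_params \<Rightarrow> bool" where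
  "sort_system P Q \<longleftrightarrow>
     name_sorts Q \<subseteq> sorts Q \<and> countable (name_sorts Q) \<and> restrictable Q \<subseteq> name_sorts Q \<and>
     name_partition (name_sorts Q) (names_of Q) \<and>
     can_receive Q \<subseteq> sorts Q \<times> sorts Q \<and>
     can_send Q \<subseteq> sorts Q \<times> sorts Q \<and>
     substitutable Q \<subseteq> sorts Q \<times> sorts Q \<and>
     sort_of Q ` (all_names Q <+> elts (Trm P) <+> elts (Pat Q)) \<subseteq> sorts Q \<and>
     (\<forall>a\<in>all_names Q. \<forall>s\<in>name_sorts Q. sort_of Q (Inl a) = s \<longleftrightarrow> a \<in> names_of Q s) \<and>
     (\<forall>(a, b)\<in>swaps Q.
        (\<forall>c\<in>all_names Q. sort_of Q (Inl (transpose a b c)) = sort_of Q (Inl c)) \<and>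
        (\<forall>M\<in>elts (Trm P). sort_of Q (Inr (Inl (swp (Trm P) a b M))) = sort_of Q (Inr (Inl M))) \<and>
        (\<forall>X\<in>elts (Pat Q). sort_of Q (Inr (Inr (swp (Pat Q) a b X))) = sort_of Q (Inr (Inr X))))"

definition sorted_substitution ::
  "('n, 't, 'c, 'a) psi_params \<Rightarrow> ('s, 'n, 't, 'x) sort_params \<Rightarrow> bool" where
  "sorted_substitution P Q \<longleftrightarrow>
     equivariant_subst (swaps Q) (sorted_ok P Q) (Trm P) (Trm P) (substT P) \<and>
     equivariant_subst (swaps Q) (sorted_ok P Q) (Trm P) (Cnd P) (substC P) \<and>
     equivariant_subst (swaps Q) (sorted_ok P Q) (Trm P) (Ass P) (substA P) \<and>
     equivariant_subst (swaps Q) (sorted_ok P Q) (Trm P) (Pat Q) (substX Q) \<and>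
     (\<forall>as Ms. is_subst (sorted_ok P Q) as Ms \<longrightarrow>
        (\<forall>M\<in>elts (Trm P).
           alpha_renaming (swaps Q) (Trm P) (substT P) M as Ms \<and>
           le_term_sort Q (sort_of Q (Inr (Inl (substT P M as Ms)))) (sort_of Q (Inr (Inl M)))) \<and>
        (\<forall>\<phi>\<in>elts (Cnd P). alpha_renaming (swaps Q) (Cnd P) (substC P) \<phi> as Ms) \<and>
        (\<forall>\<Psi>\<in>elts (Ass P). alpha_renaming (swaps Q) (Ass P) (substA P) \<Psi> as Ms) \<and>
        (\<forall>X\<in>elts (Pat Q). \<forall>xs. set xs \<in> vars Q X \<and>
             set xs \<inter> subst_names (swaps Q) (Trm P) as Ms = {} \<longrightarrow>
           le_pattern_sort Q (sort_of Q (Inr (Inr (substX Q X as Ms)))) (sort_of Q (Inr (Inr X))) \<and>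
           set xs \<in> vars Q (substX Q X as Ms) \<and>
           alpha_renaming (swaps Q) (Pat Q) (substX Q) X as Ms))"

definition sorted_matching ::
  "('n, 't, 'c, 'a) psi_params \<Rightarrow> ('s, 'n, 't, 'x) sort_params \<Rightarrow> bool" where
  "sorted_matching P Q \<longleftrightarrow>
     (\<forall>X\<in>elts (Pat Q).
        finite (vars Q X) \<and> (\<forall>V\<in>vars Q X. finite V \<and> V \<subseteq> all_names Q) \<and>
        (\<forall>(a, b)\<in>swaps Q. vars Q (swp (Pat Q) a b X) = (\<lambda>V. transpose a b ` V) ` vars Q X)) \<and>
     (\<forall>M\<in>elts (Trm P). \<forall>xs\<in>lists (all_names Q). \<forall>X\<in>elts (Pat Q).
        match Q M xs X \<subseteq> lists (elts (Trm P)) \<and>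
        (\<forall>(a, b)\<in>swaps Q.
           match Q (swp (Trm P) a b M) (map (transpose a b) xs) (swp (Pat Q) a b X) =
           map (swp (Trm P) a b) ` match Q M xs X)) \<and>
     (\<forall>M\<in>elts (Trm P). \<forall>X\<in>elts (Pat Q). \<forall>xs Ns.
        set xs \<in> vars Q X \<and> distinct xs \<and> Ns \<in> match Q M xs X \<longrightarrow>
        is_subst (sorted_ok P Q) xs Ns \<and>
        supp_tuple (swaps Q) (Trm P) Ns \<subseteq>
          supp (swaps Q) (Trm P) M \<union> (supp (swaps Q) (Pat Q) X - set xs) \<and>
        (\<forall>ys. tuple_swapping (swaps Q) xs ys \<and> set ys \<inter> supp (swaps Q) (Pat Q) X = {} \<longrightarrow>
           Ns \<in> match Q M ys (swp_tuple (Pat Q) xs ys X)))"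

text \<open>
  All requirements on a sorted psi-calculus, except that \<open>match\<close> takes values in the power set of
  the set of tuples of terms, rather than in the set of its finite subsets. The two notions have to
  be kept apart because \<open>{L. M = X[x := L]}\<close> is often infinite: in the usual calculi it contains
  all substitutable \<open>L\<close> if \<open>M = X\<close> and \<open>x\<close> is a single name fresh for \<open>X\<close>.
\<close>

definition sorted_psi_calculus_infmatch ::
  "('n, 't, 'c, 'a) psi_params \<Rightarrow> ('s, 'n, 't, 'x) sort_params \<Rightarrow> bool" where
  "sorted_psi_calculus_infmatch P Q \<longleftrightarrow>
     sort_system P Q \<and>
     logical_parameters (swaps Q) P \<and>
     nominal_set (swaps Q) (Pat Q) \<and>
     sorted_substitution P Q \<and>
     sorted_matching P Q"

definition finite_match ::
  "('n, 't, 'c, 'a) psi_params \<Rightarrow> ('s, 'n, 't, 'x) sort_params \<Rightarrow> bool" where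
  "finite_match P Q \<longleftrightarrow>
     (\<forall>M\<in>elts (Trm P). \<forall>xs\<in>lists (all_names Q). \<forall>X\<in>elts (Pat Q). finite (match Q M xs X))"

definition sorted_psi_calculus ::
  "('n, 't, 'c, 'a) psi_params \<Rightarrow> ('s, 'n, 't, 'x) sort_params \<Rightarrow> bool" where
  "sorted_psi_calculus P Q \<longleftrightarrow> sorted_psi_calculus_infmatch P Q \<and> finite_match P Q"

end

theory Submission
  imports Defs
begin

text \<open>
  Since there is only one sort, all sorting conditions are trivial. Preservation of \<open>vars\<close> under
  substitution is exactly the additional assumption on supports. In the matching requirements
  \<open>\<tilde>x \<in> vars X\<close> means \<open>\<tilde>x \<subseteq> n(X)\<close>: this makes condition (i) on
  substitution applicable, and it forces every \<open>\<tilde>y # X\<close> to be disjoint from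
  \<open>\<tilde>x\<close>, so that alpha-renaming applies.
\<close>

text \<open>Being in a support requires infinitely many partners \<open>b\<close> with
  \<open>(a, b)\<close> in \<open>N \<times> N\<close>; a single one already places \<open>a\<close>
  in \<open>N\<close>.\<close>

lemma supp_subset: "supp (N \<times> N) A x \<subseteq> N"
  by (auto simp: supp_def dest!: infinite_imp_nonempty)

lemma transpose_mem:
  "a \<in> N \<Longrightarrow> b \<in> N \<Longrightarrow> transpose a b c \<in> N \<longleftrightarrow> c \<in> N"
  by (auto simp: transpose_def)

text \<open>A transposition is its own inverse, so image membership amounts to a shifted membership.
  This turns pointwise equivariance into equations between sets.\<close>

lemma eq_transpose_imageI:
  assumes "\<And>c. transpose a b c \<in> T \<longleftrightarrow> c \<in> S"
  shows "T = transpose a b ` S"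
  by (simp add: set_eq_iff in_transpose_image_iff flip: assms)

locale total_nominal_set =
  fixes N :: "'n set" and A :: "('n, 'x) nominal"
  assumes nominal: "nominal_set (N \<times> N) A"
begin

lemma swp_closed: "a \<in> N \<Longrightarrow> b \<in> N \<Longrightarrow> x \<in> elts A \<Longrightarrow> swp A a b x \<in> elts A"
  using nominal by (auto simp: nominal_set_def)

lemma swp_swp: "a \<in> N \<Longrightarrow> b \<in> N \<Longrightarrow> x \<in> elts A \<Longrightarrow> swp A a b (swp A a b x) = x"
  using nominal by (auto simp: nominal_set_def)

lemma swp_eq_iff:
  "a \<in> N \<Longrightarrow> b \<in> N \<Longrightarrow> x \<in> elts A \<Longrightarrow> y \<in> elts A \<Longrightarrow>
    swp A a b x = swp A a b y \<longleftrightarrow> x = y"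
  by (metis swp_swp)

lemma swp_conjugate:
  "a \<in> N \<Longrightarrow> b \<in> N \<Longrightarrow> c \<in> N \<Longrightarrow> d \<in> N \<Longrightarrow> x \<in> elts A \<Longrightarrow>
    swp A a b (swp A c d x) = swp A (transpose a b c) (transpose a b d) (swp A a b x)"
  using nominal by (auto simp: nominal_set_def)

lemma finite_supp: "x \<in> elts A \<Longrightarrow> finite (supp (N \<times> N) A x)"
  using nominal by (auto simp: nominal_set_def)

text \<open>Conjugating by the swapping \<open>(a b)\<close> maps the names \<open>d\<close> for
  which \<open>(c d)\<close> moves \<open>x\<close> bijectively onto the corresponding names for the
  swapped element. Infinitude of the one set is therefore infinitude of the other.\<close>

lemma supp_swp_mem:
  assumes "a \<in> N" "b \<in> N" "x \<in> elts A"
  shows "transpose a b c \<in> supp (N \<times> N) A (swp A a b x) \<longleftrightarrow> c \<in> supp (N \<times> N) A x"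
\<comment> \<open>The conjugation law holds only for swappings of names in \<open>N\<close>; for
  \<open>c\<close> outside \<open>N\<close> both sides are false.\<close>
proof (cases "c \<in> N")
  case False
  then show ?thesis
    using assms supp_subset[of N A] transpose_mem[of a N b c] by blast
next
  case True
  let ?D = "\<lambda>c x. {d. (c, d) \<in> N \<times> N \<and> swp A c d x \<noteq> x}"
  \<comment> \<open>Read backwards, \<open>swp_conjugate\<close> pulls \<open>swp A a b\<close> to
    the outside, where it cancels by injectivity.\<close>
  have moved: "transpose a b d \<in> ?D (transpose a b c) (swp A a b x) \<longleftrightarrow> d \<in> ?D c x" for d
    using assms True
    by (auto simp: transpose_mem swp_conjugate[symmetric] swp_eq_iff swp_closed)
  have "?D (transpose a b c) (swp A a b x) = transpose a b ` ?D c x"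
    by (rule eq_transpose_imageI) (rule moved)
  then have "finite (?D (transpose a b c) (swp A a b x)) \<longleftrightarrow> finite (?D c x)"
    by (simp only:) (rule finite_image_iff, rule inj_on_subset[OF inj_transpose], simp)
  then show ?thesis
    by (simp add: supp_def)
qed

lemma supp_swp:
  assumes "a \<in> N" "b \<in> N" "x \<in> elts A"
  shows "supp (N \<times> N) A (swp A a b x) = transpose a b ` supp (N \<times> N) A x"
  by (rule eq_transpose_imageI) (rule supp_swp_mem[OF assms])

end

lemma is_subst_swp:
  assumes "nominal_set (N \<times> N) (Trm P)" "is_subst (orig_ok N P) as Ms" "a \<in> N" "b \<in> N"
  shows "is_subst (orig_ok N P) (map (transpose a b) as) (map (swp (Trm P) a b) Ms)"
proof -
  interpret total_nominal_set N "Trm P"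
    using assms(1) by unfold_locales
  have "inj_on (transpose a b) (set as)"
    by (rule inj_on_subset[OF inj_transpose]) simp
  then show ?thesis
    using assms(2-) by (auto simp: is_subst_def distinct_map list_all2_map1 list_all2_map2
        orig_ok_def transpose_mem swp_closed elim!: list_all2_mono)
qed

lemma is_subst_terms: "is_subst (orig_ok N P) as Ms \<Longrightarrow> set Ms \<subseteq> elts (Trm P)"
  by (auto simp: is_subst_def orig_ok_def list_all2_conv_all_nth in_set_conv_nth)

text \<open>\<open>orig_ok\<close> constrains the name and the term independently, so any distinct
  names in \<open>N\<close> may replace \<open>as\<close> while \<open>Ms\<close> stays the
  same.\<close>

lemma is_subst_rename:
  assumes "is_subst (orig_ok N P) as Ms" "tuple_swapping (N \<times> N) as bs"
  shows "is_subst (orig_ok N P) bs Ms"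
  using assms by (auto simp: is_subst_def tuple_swapping_def orig_ok_def list_all2_conv_all_nth)

text \<open>This is the \<open>match\<close> component of the theorem, named so that its
  equivariance can be proved without reference to \<open>Q\<close>.\<close>

definition substitution_match ::
  "'n set \<Rightarrow> ('n, 't, 'c, 'a) psi_params \<Rightarrow> 't \<Rightarrow> 'n list \<Rightarrow> 't \<Rightarrow> 't list set" where
  "substitution_match N P M xs X = {Ls. is_subst (orig_ok N P) xs Ls \<and> M = substT P X xs Ls}"

lemma substitution_match_terms: "substitution_match N P M xs X \<subseteq> lists (elts (Trm P))"
  unfolding substitution_match_def using is_subst_terms[of N P xs] by (auto simp: in_lists_conv_set)

lemma substitution_match_swp:
  assumes nom: "nominal_set (N \<times> N) (Trm P)"
    and eqv: "equivariant_subst (N \<times> N) (orig_ok N P) (Trm P) (Trm P) (substT P)"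
    and "X \<in> elts (Trm P)" "a \<in> N" "b \<in> N" "Ls \<in> substitution_match N P M xs X"
  shows "map (swp (Trm P) a b) Ls \<in> substitution_match N P (swp (Trm P) a b M)
    (map (transpose a b) xs) (swp (Trm P) a b X)"
proof -
  from assms(6) have "is_subst (orig_ok N P) xs Ls" "M = substT P X xs Ls"
    by (auto simp: substitution_match_def)
  with assms(3-5) eqv show ?thesis
    unfolding substitution_match_def mem_Collect_eq
    by (intro conjI is_subst_swp[OF nom]) (auto simp: equivariant_subst_def)
qed

text \<open>Equivariance of substitution gives one inclusion. The other is the same inclusion at the
  swapped arguments, since swappings are involutions.\<close>

lemma substitution_match_equivariant:
  assumes nom: "nominal_set (N \<times> N) (Trm P)"
    and eqv: "equivariant_subst (N \<times> N) (orig_ok N P) (Trm P) (Trm P) (substT P)"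
    and "X \<in> elts (Trm P)" "M \<in> elts (Trm P)" "a \<in> N" "b \<in> N"
  shows "substitution_match N P (swp (Trm P) a b M) (map (transpose a b) xs) (swp (Trm P) a b X) =
    map (swp (Trm P) a b) ` substitution_match N P M xs X" (is "?L = ?R")
proof
  interpret total_nominal_set N "Trm P"
    using nom by unfold_locales
  show "?R \<subseteq> ?L"
    using substitution_match_swp[OF nom eqv] assms by blast
  show "?L \<subseteq> ?R"
  proof
    fix Ls assume L: "Ls \<in> ?L"
    \<comment> \<open>Swapping the already swapped arguments a second time restores
      \<open>M\<close>, \<open>xs\<close> and \<open>X\<close>.\<close>
    have "map (swp (Trm P) a b) Ls \<in> substitution_match N P M xs X"
      using substitution_match_swp[OF nom eqv swp_closed[OF assms(5,6,3)] assms(5,6) L] assms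
      by (simp add: swp_swp)
    moreover have "map (swp (Trm P) a b) (map (swp (Trm P) a b) Ls) = Ls"
    proof -
      have "set Ls \<subseteq> elts (Trm P)"
        using L is_subst_terms[of N P _ Ls] by (auto simp: substitution_match_def)
      then show ?thesis
        using assms by (auto simp: swp_swp intro!: map_idI)
    qed
    ultimately show "Ls \<in> ?R"
      by (metis image_eqI)
  qed
qed

theorem theorem2p7:
  fixes N :: "'n set"
    and P :: "('n, 't, 'c, 'a) psi_params"
    and s :: 's
    and Q :: "('s, 'n, 't, 't) sort_params"
  assumes "original_psi_calculus N P"
    and "\<And>M as Ls. M \<in> elts (Trm P) \<Longrightarrow> is_subst (orig_ok N P) as Ls \<Longrightarrow>
           supp (N \<times> N) (Trm P) M - subst_names (N \<times> N) (Trm P) as Ls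
             \<subseteq> supp (N \<times> N) (Trm P) (substT P M as Ls)"
    and "Q = \<lparr>
           sorts = {s},
           name_sorts = {s},
           restrictable = {s},
           names_of = (\<lambda>_. N),
           can_receive = {(s, s)},
           can_send = {(s, s)},
           substitutable = {(s, s)},
           sort_of = (\<lambda>_. s),
           Pat = Trm P,
           substX = substT P,
           vars = (\<lambda>X. Pow (supp (N \<times> N) (Trm P) X)),
           match = (\<lambda>M xs X. {Ls. is_subst (orig_ok N P) xs Ls \<and> M = substT P X xs Ls}) \<rparr>"
  shows "sorted_psi_calculus_infmatch P Q \<and>
         (sorted_psi_calculus P Q \<longleftrightarrow> finite_match P Q)"
proof -
  interpret total_nominal_set N "Trm P"
    using assms(1) by unfold_locales (simp add: original_psi_calculus_def logical_parameters_def)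
  have params: "logical_parameters (N \<times> N) P"
    and N: "countable N" "infinite N"
    and substT: "orig_subst_function N P (Trm P) (substT P)"
    and substC: "orig_subst_function N P (Cnd P) (substC P)"
    and substA: "orig_subst_function N P (Ass P) (substA P)"
    using assms(1) by (auto simp: original_psi_calculus_def)
  \<comment> \<open>The last equation folds the set comprehension into
    \<open>substitution_match\<close>, so that the lemmas above apply.\<close>
  have Q [simp]: "sorts Q = {s}" "name_sorts Q = {s}" "restrictable Q = {s}"
    "names_of Q = (\<lambda>_. N)" "can_receive Q = {(s, s)}" "can_send Q = {(s, s)}"
    "substitutable Q = {(s, s)}" "sort_of Q = (\<lambda>_. s)" "Pat Q = Trm P" "substX Q = substT P"
    "vars Q = (\<lambda>X. Pow (supp (N \<times> N) (Trm P) X))"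
    "match Q = substitution_match N P"
    by (simp_all add: assms(3) substitution_match_def fun_eq_iff)
  have names [simp]: "all_names Q = N" and swaps [simp]: "swaps Q = N \<times> N"
    by (auto simp: all_names_def swaps_def swappings_def)
  \<comment> \<open>With a single sort, the condition on \<open>substitutable\<close> always holds,
    so both calculi have the same substitutions.\<close>
  have ok [simp]: "sorted_ok P Q = orig_ok N P"
    by (auto simp: sorted_ok_def orig_ok_def fun_eq_iff)
  have "sort_system P Q"
    using N by (auto simp: sort_system_def name_partition_def disjoint_family_on_def)
  moreover have "sorted_substitution P Q"
  proof -
    \<comment> \<open>Names of \<open>xs\<close> lie in the support of \<open>X\<close> and avoid
      those of the substitution, so the extra assumption keeps them in the support of the
      result.\<close>
    have "set xs \<subseteq> supp (N \<times> N) (Trm P) (substT P X as Ms)"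
      if "X \<in> elts (Trm P)" "is_subst (orig_ok N P) as Ms" "set xs \<subseteq> supp (N \<times> N) (Trm P) X"
        "set xs \<inter> subst_names (N \<times> N) (Trm P) as Ms = {}" for X xs as Ms
      using assms(2)[OF that(1,2)] that(3,4) by blast
    then show ?thesis
      using substT substC substA
      by (simp add: sorted_substitution_def orig_subst_function_def le_term_sort_def
          le_pattern_sort_def)
  qed
  moreover have "sorted_matching P Q"
  proof -
    have eqv: "equivariant_subst (N \<times> N) (orig_ok N P) (Trm P) (Trm P) (substT P)"
      using substT by (simp add: orig_subst_function_def)
    have vars: "\<forall>X\<in>elts (Trm P). finite (Pow (supp (N \<times> N) (Trm P) X)) \<and>
        (\<forall>V\<in>Pow (supp (N \<times> N) (Trm P) X). finite V \<and> V \<subseteq> N) \<and>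
        (\<forall>(a, b)\<in>N \<times> N. Pow (supp (N \<times> N) (Trm P) (swp (Trm P) a b X)) =
           (`) (transpose a b) ` Pow (supp (N \<times> N) (Trm P) X))"
    proof
      fix X assume X: "X \<in> elts (Trm P)"
      show "finite (Pow (supp (N \<times> N) (Trm P) X)) \<and>
        (\<forall>V\<in>Pow (supp (N \<times> N) (Trm P) X). finite V \<and> V \<subseteq> N) \<and>
        (\<forall>(a, b)\<in>N \<times> N. Pow (supp (N \<times> N) (Trm P) (swp (Trm P) a b X)) =
           (`) (transpose a b) ` Pow (supp (N \<times> N) (Trm P) X))"
      proof (intro conjI)
        show "\<forall>(a, b)\<in>N \<times> N. Pow (supp (N \<times> N) (Trm P) (swp (Trm P) a b X)) =
           (`) (transpose a b) ` Pow (supp (N \<times> N) (Trm P) X)"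
          \<comment> \<open>Forming power sets commutes with images, which reduces equivariance of
            \<open>vars\<close> to that of the support.\<close>
          by (clarify, simp only: supp_swp[OF _ _ X] image_Pow_surj[OF refl])
        show "\<forall>V\<in>Pow (supp (N \<times> N) (Trm P) X). finite V \<and> V \<subseteq> N"
          using finite_subset[OF _ finite_supp[OF X]] supp_subset[of N "Trm P" X] by blast
      qed (simp add: finite_supp[OF X])
    qed
    have match: "\<forall>M\<in>elts (Trm P). \<forall>xs\<in>lists N. \<forall>X\<in>elts (Trm P).
        substitution_match N P M xs X \<subseteq> lists (elts (Trm P)) \<and>
        (\<forall>(a, b)\<in>N \<times> N.
           substitution_match N P (swp (Trm P) a b M) (map (transpose a b) xs) (swp (Trm P) a b X) =
           map (swp (Trm P) a b) ` substitution_match N P M xs X)"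
      by (intro ballI conjI substitution_match_terms)
        (clarify, rule substitution_match_equivariant[OF nominal eqv])
    have matching: "is_subst (orig_ok N P) xs Ns \<and>
        supp_tuple (N \<times> N) (Trm P) Ns \<subseteq> supp (N \<times> N) (Trm P) M \<and>
        (\<forall>ys. tuple_swapping (N \<times> N) xs ys \<and> set ys \<inter> supp (N \<times> N) (Trm P) X = {} \<longrightarrow>
           Ns \<in> substitution_match N P M ys (swp_tuple (Trm P) xs ys X))"
      if X: "X \<in> elts (Trm P)" and xs: "set xs \<subseteq> supp (N \<times> N) (Trm P) X"
        and Ns: "Ns \<in> substitution_match N P M xs X" for M X xs Ns
    proof -
      have sub: "is_subst (orig_ok N P) xs Ns" and M: "M = substT P X xs Ns"
        using Ns by (auto simp: substitution_match_def)
      \<comment> \<open>Condition (i) on substitution bounds the names of \<open>Ns\<close> by those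
        of \<open>M\<close> alone, which is stronger than the bound in the matching
        requirement.\<close>
      have i: "supp_tuple (N \<times> N) (Trm P) Ns \<subseteq> supp (N \<times> N) (Trm P) M"
        and alpha: "alpha_renaming (N \<times> N) (Trm P) (substT P) X xs Ns"
        using substT X xs sub M unfolding orig_subst_function_def by blast+
      have "Ns \<in> substitution_match N P M ys (swp_tuple (Trm P) xs ys X)"
        if ys: "tuple_swapping (N \<times> N) xs ys" "set ys \<inter> supp (N \<times> N) (Trm P) X = {}" for ys
      proof -
        have "set ys \<inter> set xs = {}"
          using xs ys(2) by blast
        then have "M = substT P (swp_tuple (Trm P) xs ys X) ys Ns"
          using alpha ys M by (simp add: alpha_renaming_def)
        then show ?thesis
          using is_subst_rename[OF sub ys(1)] by (simp add: substitution_match_def)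
      qed
      then show ?thesis
        using sub i by blast
    qed
    show ?thesis
      unfolding sorted_matching_def Q names swaps ok
    proof (intro conjI)
      show "\<forall>M\<in>elts (Trm P). \<forall>X\<in>elts (Trm P). \<forall>xs Ns.
        set xs \<in> Pow (supp (N \<times> N) (Trm P) X) \<and> distinct xs \<and>
          Ns \<in> substitution_match N P M xs X \<longrightarrow>
        is_subst (orig_ok N P) xs Ns \<and>
        supp_tuple (N \<times> N) (Trm P) Ns
          \<subseteq> supp (N \<times> N) (Trm P) M \<union> (supp (N \<times> N) (Trm P) X - set xs) \<and>
        (\<forall>ys. tuple_swapping (N \<times> N) xs ys \<and> set ys \<inter> supp (N \<times> N) (Trm P) X = {} \<longrightarrow>
           Ns \<in> substitution_match N P M ys (swp_tuple (Trm P) xs ys X))"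
        using matching by (meson PowD le_supI1)
    qed (fact vars match)+
  qed
  ultimately have "sorted_psi_calculus_infmatch P Q"
    using params nominal by (simp add: sorted_psi_calculus_infmatch_def)
  \<comment> \<open>The equivalence is now immediate, since \<open>finite_match\<close> is the only
    other conjunct of \<open>sorted_psi_calculus\<close>.\<close>
  then show ?thesis
    by (simp add: sorted_psi_calculus_def)
qed

end
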